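(* Suppose that the trust-region subproblem $\min_{\|x\|\le\Delta}\{\frac12 x^TAx+x^Tg\}$ is in easy case and that $\lambda_*>0$. There is a scalar $\widetilde\varrho>0$ such that if $0<|\varepsilon|<\widetilde\varrho$, then (i) $\lambda_*(\varepsilon)>0$ is the rightmost eigenvalue of $M(\varepsilon)$, and $\lim_{\varepsilon\to0}\lambda_*(\varepsilon)=\lambda_*$; (ii) $\lambda_*(\varepsilon)$ is differentiable at $\varepsilon=0$, and $$\lambda_*'(0)=\frac{\mathrm d\lambda_*(\varepsilon)}{\mathrm d\varepsilon}\bigg|_{\varepsilon=0}=\frac{\operatorname{sign}(g^Ty_2)\,\|y_1\|}{y_1^Ty_2\,\Delta}\cdot y_2^T(Ex_*+e).$$
   Context: $\|\cdot\|$ is the Euclidean norm. $A\in\mathbb R^{n\times n}$ is symmetric, $0\ne g\in\mathbb R^n$, $\Delta>0$; $E\in\mathbb R^{n\times n}$ is symmetric, $e\in\mathbb R^n$, $\varepsilon\in\mathbb R$; $A(\varepsilon)=A+\varepsilon E$, $g(\varepsilon)=g+\varepsilon e$. Trust-region subproblem (TRS): for symmetric $B\in\mathbb R^{n\times n}$ and $b\in\mathbb R^n$, consider $\min_{\|x\|\le\Delta}\{\frac12x^TBx+x^Tb\}$. A vector $x_*$ with $\|x_*\|\le\Delta$ is a global minimizer iff there is a Lagrange multiplier $\lambda_*\ge0$ with $(B+\lambda_*I)x_*=-b$, $\lambda_*(\Delta-\|x_*\|)=0$ and $B+\lambda_*I$ positive semidefinite. The TRS is in easy case if $B+\lambda_*I$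 is positive definite (equivalently $\lambda_*$ exceeds minus the smallest eigenvalue of $B$); then the minimizer is unique. $(\lambda_*,x_* )$ denotes the multiplier and solution for $(B,b)=(A,g)$, and $(\lambda_*(\varepsilon),x_*(\varepsilon))$ those for $(B,b)=(A(\varepsilon),g(\varepsilon))$ (the perturbed TRS), so $\lambda_*(0)=\lambda_*$, $x_*(0)=x_*$. Standing assumption: the $\varepsilon$ considered are such that the perturbed TRS is also in easy case. Let $$M(\varepsilon)=\begin{pmatrix}-A(\varepsilon)&\frac{g(\varepsilon)g(\varepsilon)^T}{\Delta^2}\\ I&-A(\varepsilon)\end{pmatrix}\in\mathbb R^{2n\times2n},\qquad M=M(0).$$ A rightmost eigenvalue is one of largest real part. $y=(y_1^T,y_2^T)^T$ with $y_1,y_2\in\mathbb R^n$ is a unit-length real right eigenvector of $M$ for the eigenvalue $\lambda_*$. *)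

theory Defs
  imports "HOL-Analysis.Analysis"
begin

definition pos_semidef :: "real^'n^'n \<Rightarrow> bool" where
  "pos_semidef B \<longleftrightarrow> transpose B = B \<and> (\<forall>v. v \<bullet> (B *v v) \<ge> 0)"

definition pos_def :: "real^'n^'n \<Rightarrow> bool" where
  "pos_def B \<longleftrightarrow> transpose B = B \<and> (\<forall>v. v \<noteq> 0 \<longrightarrow> v \<bullet> (B *v v) > 0)"

definition trs_objective :: "real^'n^'n \<Rightarrow> real^'n \<Rightarrow> real^'n \<Rightarrow> real" where
  "trs_objective B b x = 1/2 * (x \<bullet> (B *v x)) + x \<bullet> b"

definition trs_minimizer :: "real^'n^'n \<Rightarrow> real^'n \<Rightarrow> real \<Rightarrow> real^'n \<Rightarrow> bool" where
  "trs_minimizer B b \<Delta> x \<longleftrightarrow>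
     norm x \<le> \<Delta> \<and> (\<forall>z. norm z \<le> \<Delta> \<longrightarrow> trs_objective B b x \<le> trs_objective B b z)"

definition trs_multiplier :: "real^'n^'n \<Rightarrow> real^'n \<Rightarrow> real \<Rightarrow> real^'n \<Rightarrow> real \<Rightarrow> bool" where
  "trs_multiplier B b \<Delta> x l \<longleftrightarrow>
     l \<ge> 0 \<and> (B + l *\<^sub>R mat 1) *v x = - b \<and> l * (\<Delta> - norm x) = 0 \<and>
     pos_semidef (B + l *\<^sub>R mat 1)"

definition trs_solution :: "real^'n^'n \<Rightarrow> real^'n \<Rightarrow> real \<Rightarrow> real \<Rightarrow> real^'n \<Rightarrow> bool" where
  "trs_solution B b \<Delta> l x \<longleftrightarrow> trs_minimizer B b \<Delta> x \<and> trs_multiplier B b \<Delta> x l"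

text \<open>The multiplier of a trust-region subproblem is unique, so quantifying it existentially
  here expresses a property of the subproblem itself.\<close>

definition trs_easy_case :: "real^'n^'n \<Rightarrow> real^'n \<Rightarrow> real \<Rightarrow> bool" where
  "trs_easy_case B b \<Delta> \<longleftrightarrow>
     (\<exists>l x. trs_solution B b \<Delta> l x \<and> pos_def (B + l *\<^sub>R mat 1))"

text \<open>Vectors and matrices of dimension \<open>2n\<close> are indexed by the sum type \<open>'n + 'n\<close>:
  \<open>Inl\<close> selects the first block, \<open>Inr\<close> the second.\<close>

definition block_matrix ::
  "'a^'n^'n \<Rightarrow> 'a^'n^'n \<Rightarrow> 'a^'n^'n \<Rightarrow> 'a^'n^'n \<Rightarrow> 'a^('n + 'n)^('n + 'n)" where
  "block_matrix P Q R S = (\<chi> i j.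
     case i of
       Inl k \<Rightarrow> (case j of Inl l \<Rightarrow> P $ k $ l | Inr l \<Rightarrow> Q $ k $ l)
     | Inr k \<Rightarrow> (case j of Inl l \<Rightarrow> R $ k $ l | Inr l \<Rightarrow> S $ k $ l))"

definition block_vector :: "'a^'n \<Rightarrow> 'a^'n \<Rightarrow> 'a^('n + 'n)" where
  "block_vector u v = (\<chi> i. case i of Inl k \<Rightarrow> u $ k | Inr k \<Rightarrow> v $ k)"

definition outer_product :: "real^'n \<Rightarrow> real^'n \<Rightarrow> real^'n^'n" where
  "outer_product u v = (\<chi> i j. u $ i * v $ j)"

definition trs_matrix :: "real^'n^'n \<Rightarrow> real^'n \<Rightarrow> real \<Rightarrow> real^('n + 'n)^('n + 'n)" where
  "trs_matrix B b \<Delta> =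
     block_matrix (- B) ((1 / \<Delta>\<^sup>2) *\<^sub>R outer_product b b) (mat 1) (- B)"

definition complex_eigenvalue :: "real^'m^'m \<Rightarrow> complex \<Rightarrow> bool" where
  "complex_eigenvalue N \<mu> \<longleftrightarrow>
     (\<exists>v. v \<noteq> 0 \<and> (\<chi> i j. complex_of_real (N $ i $ j)) *v v = \<mu> *s v)"

definition rightmost_eigenvalue :: "real^'m^'m \<Rightarrow> complex \<Rightarrow> bool" where
  "rightmost_eigenvalue N \<mu> \<longleftrightarrow>
     complex_eigenvalue N \<mu> \<and> (\<forall>\<nu>. complex_eigenvalue N \<nu> \<longrightarrow> Re \<nu> \<le> Re \<mu>)"

end

theory Submission
  imports Defs
begin

text \<open>Let \<open>H = A + l I\<close>, which is coercive, and let \<open>z(\<epsilon>, m)\<close> solve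
  \<open>(A + \<epsilon> E + m I) z = - (g + \<epsilon> e)\<close> for \<open>m\<close> near \<open>l\<close>. At \<open>\<epsilon> = 0\<close> the norm of \<open>z\<close> is strictly
  decreasing in \<open>m\<close>, so \<open>\<parallel>z\<parallel> = \<Delta>\<close> keeps a root \<open>m\<close> near \<open>l\<close> for small \<open>\<epsilon>\<close>; the perturbed
  subproblem is then in easy case, and uniqueness identifies this root with its multiplier.

  As \<open>x\<close> and \<open>x(\<epsilon>)\<close> have equal norms, \<open>x \<bullet> (x(\<epsilon>) - x) = - \<parallel>x(\<epsilon>) - x\<parallel>\<^sup>2 / 2\<close> is of second order.
  Testing the difference of the two stationarity equations against \<open>w = H\<^sup>-\<^sup>1 x\<close> therefore leaves only
  \<open>(l(\<epsilon>) - l) (w \<bullet> x(\<epsilon>)) = - \<epsilon> w \<bullet> (E x(\<epsilon>) + e) + O(\<epsilon>\<^sup>2)\<close>, and \<open>y\<^sub>1\<close>, \<open>y\<^sub>2\<close> are the same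
  multiple of \<open>x\<close>, \<open>w\<close>.

  For an eigenvalue \<open>\<mu>\<close> with eigenvector \<open>(u, v)\<close>, one has \<open>(B + \<mu>) v = u\<close> and
  \<open>(B + \<mu>) u = (b\<^sup>T v / \<Delta>\<^sup>2) b\<close>, hence \<open>u\<^sup>T u = (b\<^sup>T v)\<^sup>2 / \<Delta>\<^sup>2\<close> and \<open>\<bar>b\<^sup>T v\<bar> / \<Delta> \<le> \<parallel>u\<parallel>\<close>. On the
  other hand \<open>u + (\<mu> - l) H\<^sup>-\<^sup>1 u\<close> is a multiple of \<open>x\<close> of norm \<open>\<bar>b\<^sup>T v\<bar> / \<Delta>\<close>, and for
  \<open>Re \<mu> \<ge> l\<close> its norm exceeds that of \<open>u\<close> unless \<open>\<mu> = l\<close>.\<close>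

section \<open>Matrix-vector algebra and coercivity of positive definite matrices\<close>

lemma matrix_add_scaleR_mult:
  fixes B C :: "real^'n^'m" and v :: "real^'n"
  shows "(B + t *\<^sub>R C) *v v = B *v v + t *\<^sub>R (C *v v)"
  by (simp add: matrix_vector_mult_add_rdistrib scaleR_matrix_vector_assoc)

lemma matrix_shift_mult:
  fixes B :: "real^'n^'n" and v :: "real^'n"
  shows "(B + t *\<^sub>R mat 1) *v v = B *v v + t *\<^sub>R v"
  by (simp add: matrix_add_scaleR_mult)

lemma symmetric_inner_matrix:
  fixes B :: "real^'n^'n"
  assumes "transpose B = B"
  shows "u \<bullet> (B *v v) = v \<bullet> (B *v u)"
  by (metis assms dot_lmul_matrix inner_commute transpose_matrix_vector)

text \<open>The quadratic form attains a positive minimum on the compact unit sphere; this minimum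
  serves as \<open>c\<close>, and homogeneity of degree two extends the bound to all
  vectors.\<close>

lemma pos_def_coercive:
  fixes B :: "real^'n^'n"
  assumes "pos_def B"
  obtains c where "c > 0" "\<And>v. c * (v \<bullet> v) \<le> v \<bullet> (B *v v)"
proof -
  have cont: "continuous_on (sphere (0::real^'n) 1) (\<lambda>u. u \<bullet> (B *v u))"
    by (intro continuous_intros linear_continuous_on matrix_vector_mul_bounded_linear)
  have ne: "sphere (0::real^'n) 1 \<noteq> {}" by simp
  obtain w :: "real^'n" where w: "norm w = 1"
    and min: "\<And>u. norm u = 1 \<Longrightarrow> w \<bullet> (B *v w) \<le> u \<bullet> (B *v u)"
    using continuous_attains_inf[OF compact_sphere ne cont] by auto
  show ?thesis
  proof
    show "0 < w \<bullet> (B *v w)"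
      using assms w unfolding pos_def_def by (metis norm_zero zero_neq_one)
    fix v :: "real^'n"
    show "(w \<bullet> (B *v w)) * (v \<bullet> v) \<le> v \<bullet> (B *v v)"
    proof (cases "v = 0")
      case False
      define u where "u = (1 / norm v) *\<^sub>R v"
      have u: "norm u = 1" "v = norm v *\<^sub>R u" using False by (auto simp: u_def)
      have "v \<bullet> (B *v v) = (norm v)\<^sup>2 * (u \<bullet> (B *v u))"
        by (subst (1 2) u(2)) (simp add: matrix_vector_mult_scaleR power2_eq_square)
      then show ?thesis
        using mult_left_mono[OF min[OF u(1)], of "(norm v)\<^sup>2"]
        by (simp add: power2_norm_eq_inner mult.commute)
    qed simp
  qed
qed

lemma pos_def_inj:
  fixes B :: "real^'n^'n"
  assumes "pos_def B"
  shows "inj ((*v) B)"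
proof -
  have "v = 0" if "B *v v = 0" for v
    using assms that unfolding pos_def_def by (metis inner_zero_right less_irrefl)
  then show ?thesis
    by (simp add: linear_injective_0)
qed

lemma pos_def_solvable:
  fixes B :: "real^'n^'n"
  assumes "pos_def B"
  shows "\<exists>x. B *v x = b"
  using linear_injective_imp_surjective[OF _ pos_def_inj[OF assms]]
  by (metis matrix_vector_mul_linear surjD)

section \<open>Stability of coercive linear systems\<close>

text \<open>Testing \<open>H *v (x - z) = b - H *v z\<close> against \<open>x - z\<close> and
  cancelling one factor \<open>norm (x - z)\<close> bounds the error by the residual.\<close>

lemma coercive_solution_dist:
  fixes H :: "real^'n^'n"
  assumes "\<And>v. c * (v \<bullet> v) \<le> v \<bullet> (H *v v)" and "H *v x = b"
  shows "c * norm (x - z) \<le> norm (b - H *v z)"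
proof (cases "x = z")
  case False
  have "c * ((x - z) \<bullet> (x - z)) \<le> (x - z) \<bullet> (b - H *v z)"
    using assms(1)[of "x - z"] assms(2) by (simp add: matrix_vector_mult_diff_distrib)
  also have "\<dots> \<le> norm (x - z) * norm (b - H *v z)" by (rule norm_cauchy_schwarz)
  finally have "norm (x - z) * (c * norm (x - z)) \<le> norm (x - z) * norm (b - H *v z)"
    by (simp add: dot_square_norm power2_eq_square mult_ac)
  then show ?thesis using False by simp
qed simp

text \<open>The residual of the fixed vector \<open>x0\<close> tends to 0, and the coercivity
  constant is common to all \<open>t\<close>. The filter is arbitrary because the lemma serves both
  for the limit in \<epsilon> and for continuity in the multiplier.\<close>

lemma coercive_solution_tendsto:
  fixes H :: "'t \<Rightarrow> real^'n^'n"
  assumes "c > 0"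
    and "\<forall>\<^sub>F t in F. (\<forall>v. c * (v \<bullet> v) \<le> v \<bullet> (H t *v v)) \<and> H t *v x t = b t"
    and "(H \<longlongrightarrow> H0) F" and "(b \<longlongrightarrow> b0) F" and "H0 *v x0 = b0"
  shows "(x \<longlongrightarrow> x0) F"
proof -
  have "((\<lambda>t. H t *v x0) \<longlongrightarrow> H0 *v x0) F"
    unfolding matrix_vector_mult_def
    by (intro tendsto_vec_lambda tendsto_sum tendsto_mult tendsto_vec_nth tendsto_const assms)
  then have "((\<lambda>t. b t - H t *v x0) \<longlongrightarrow> 0) F"
    using tendsto_diff[OF assms(4)] assms(5) by fastforce
  then have "((\<lambda>t. norm (b t - H t *v x0) / c) \<longlongrightarrow> 0) F"
    by (simp add: tendsto_norm_zero tendsto_divide_zero)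
  moreover have "\<forall>\<^sub>F t in F. norm (x t - x0) \<le> norm (b t - H t *v x0) / c"
    using assms(2)
  proof eventually_elim
    case (elim t)
    then show ?case
      using coercive_solution_dist[of c "H t" "x t" "b t" x0] assms(1) by (simp add: field_simps)
  qed
  ultimately have "((\<lambda>t. x t - x0) \<longlongrightarrow> 0) F"
    by (rule Lim_null_comparison[rotated])
  then show ?thesis by (simp add: LIM_zero_iff)
qed

text \<open>The difference \<open>x1 - x2\<close> solves the system with right-hand side
  \<open>(l2 - l1) *\<^sub>R x2\<close>; testing with \<open>x1 - x2\<close> gives
  \<open>x2 \<bullet> x2 < x1 \<bullet> x2\<close>, and Cauchy-Schwarz concludes.\<close>

lemma shifted_solution_norm_less:
  fixes B :: "real^'n^'n"
  assumes "pos_def (B + l1 *\<^sub>R mat 1)" and "l1 < l2" and "x2 \<noteq> 0"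
    and eq: "(B + l1 *\<^sub>R mat 1) *v x1 = (B + l2 *\<^sub>R mat 1) *v x2"
  shows "norm x2 < norm x1"
proof -
  have d: "(B + l1 *\<^sub>R mat 1) *v (x1 - x2) = (l2 - l1) *\<^sub>R x2"
    using eq by (simp add: matrix_shift_mult scaleR_matrix_vector_assoc[symmetric] algebra_simps)
  have "x1 - x2 \<noteq> 0"
    using d assms(2,3) by auto
  then have "(x1 - x2) \<bullet> ((l2 - l1) *\<^sub>R x2) > 0"
    using assms(1) d unfolding pos_def_def by metis
  then have "x2 \<bullet> x2 < x1 \<bullet> x2"
    using assms(2) by (simp add: inner_diff_left zero_less_mult_iff)
  also have "\<dots> \<le> norm x1 * norm x2" by (rule norm_cauchy_schwarz)
  finally show ?thesis
    by (simp add: dot_square_norm power2_eq_square assms(3))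
qed

section \<open>Optimality and uniqueness for the trust-region subproblem\<close>

text \<open>Adding \<open>l / 2 * \<parallel>z\<parallel>\<^sup>2\<close> to the objective gives a quadratic with Hessian \<open>B + l I\<close> whose
  gradient vanishes at \<open>x\<close>.\<close>

lemma trs_objective_diff:
  fixes B :: "real^'n^'n"
  assumes "transpose B = B" and "(B + l *\<^sub>R mat 1) *v x = - b"
  shows "trs_objective B b z - trs_objective B b x =
    1/2 * ((z - x) \<bullet> ((B + l *\<^sub>R mat 1) *v (z - x))) + l/2 * (x \<bullet> x - z \<bullet> z)"
proof -
  have b: "b = - (B *v x) - l *\<^sub>R x"
    using assms(2) by (simp add: matrix_shift_mult) (metis add.inverse_inverse minus_add_distrib diff_conv_add_uminus)
  show ?thesis
    using symmetric_inner_matrix[OF assms(1), of x z]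
    unfolding trs_objective_def b
    by (simp add: matrix_shift_mult matrix_vector_mult_diff_distrib inner_diff_left
        inner_diff_right inner_add_right inner_commute[of z x] field_simps)
qed

text \<open>Complementarity makes the last term of \<open>trs_objective_diff\<close> nonnegative:
  either \<open>l = 0\<close>, or \<open>x\<close> lies on the boundary and \<open>z\<close> cannot
  be longer.\<close>

lemma trs_multiplier_objective_ge:
  fixes B :: "real^'n^'n"
  assumes "transpose B = B" and "trs_multiplier B b \<Delta> x l" and "norm x \<le> \<Delta>" and "norm z \<le> \<Delta>"
  shows "1/2 * ((z - x) \<bullet> ((B + l *\<^sub>R mat 1) *v (z - x)))
    \<le> trs_objective B b z - trs_objective B b x"
proof -
  have "l * (z \<bullet> z) \<le> l * (x \<bullet> x)"
  proof (cases "l = 0")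
    case False
    then have "norm x = \<Delta>" "l \<ge> 0" using assms(2) by (auto simp: trs_multiplier_def)
    then show ?thesis
      using assms(4) by (intro mult_left_mono) (auto simp: dot_square_norm)
  qed simp
  then show ?thesis
    using trs_objective_diff[of B l x b z] assms(1,2)
    by (simp add: trs_multiplier_def algebra_simps)
qed

lemma trs_solutionI:
  fixes B :: "real^'n^'n"
  assumes "transpose B = B" and "l \<ge> 0" and "pos_def (B + l *\<^sub>R mat 1)"
    and "(B + l *\<^sub>R mat 1) *v x = - b" and "norm x = \<Delta>"
  shows "trs_solution B b \<Delta> l x"
proof -
  have nonneg: "v \<bullet> ((B + l *\<^sub>R mat 1) *v v) \<ge> 0" for v
    using assms(3) unfolding pos_def_def by (cases "v = 0") (auto simp: less_imp_le)
  have "pos_semidef (B + l *\<^sub>R mat 1)"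
    using assms(3) nonneg unfolding pos_semidef_def pos_def_def by simp
  then have mult: "trs_multiplier B b \<Delta> x l"
    using assms by (simp add: trs_multiplier_def)
  have "trs_objective B b x \<le> trs_objective B b z" if "norm z \<le> \<Delta>" for z
    using trs_multiplier_objective_ge[OF assms(1) mult _ that] nonneg[of "z - x"] assms(5) by simp
  then show ?thesis
    using mult assms(5) by (simp add: trs_solution_def trs_minimizer_def)
qed

text \<open>Both points are minimizers, so the quadratic lower bound on the objective gap is at most
  0, and definiteness gives \<open>z = x\<close>. The two stationarity equations then differ by a
  multiple of \<open>x\<close>, which forces \<open>m = l\<close>.\<close>

lemma trs_solution_unique:
  fixes B :: "real^'n^'n"
  assumes "transpose B = B" and "trs_solution B b \<Delta> l x" and "pos_def (B + l *\<^sub>R mat 1)"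
    and "trs_solution B b \<Delta> m z" and "x \<noteq> 0"
  shows "m = l" "z = x"
proof -
  have "norm z \<le> \<Delta>" "norm x \<le> \<Delta>" "trs_multiplier B b \<Delta> x l"
    "trs_objective B b z \<le> trs_objective B b x"
    using assms(2,4) by (auto simp: trs_solution_def trs_minimizer_def)
  then have "(z - x) \<bullet> ((B + l *\<^sub>R mat 1) *v (z - x)) \<le> 0"
    using trs_multiplier_objective_ge[OF assms(1), of b \<Delta> x l z] by simp
  then have "z - x = 0"
    using assms(3) unfolding pos_def_def by (meson not_less)
  then show zx: "z = x" by simp
  have l: "(B + l *\<^sub>R mat 1) *v x = - b" and m: "(B + m *\<^sub>R mat 1) *v x = - b"
    using assms(2,4) zx by (auto simp: trs_solution_def trs_multiplier_def)
  have "l *\<^sub>R x = m *\<^sub>R x"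
    using l m by (metis add_left_cancel matrix_shift_mult)
  then show "m = l" using assms(5) by simp
qed

section \<open>Existence of a multiplier for the perturbed subproblem\<close>

lemma trs_perturbed_multiplier_exists:
  fixes A E :: "real^'n^'n" and g e x :: "real^'n"
  assumes symA: "transpose A = A" and symE: "transpose E = E"
    and "g \<noteq> 0" and "l > 0" and "c > 0"
    and coercive: "\<And>v. c * (v \<bullet> v) \<le> v \<bullet> ((A + l *\<^sub>R mat 1) *v v)"
    and x: "(A + l *\<^sub>R mat 1) *v x = - g" "norm x = \<Delta>"
  obtains \<rho> where "\<rho> > 0"
    "\<And>\<epsilon>. \<bar>\<epsilon>\<bar> < \<rho> \<Longrightarrow> \<exists>m z. m > 0 \<and> \<bar>m - l\<bar> \<le> c / 2 \<and>
      pos_def (A + \<epsilon> *\<^sub>R E + m *\<^sub>R mat 1) \<and>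
      (A + \<epsilon> *\<^sub>R E + m *\<^sub>R mat 1) *v z = - (g + \<epsilon> *\<^sub>R e) \<and> norm z = \<Delta>"
proof -
  obtain K where K: "K > 0" "\<And>v. norm (E *v v) \<le> norm v * K"
    using bounded_linear.pos_bounded[OF matrix_vector_mul_bounded_linear] by blast
  \<comment> \<open>The bound c/2 on \<delta> preserves definiteness, and l/2 keeps the multiplier
    positive. The radius \<open>r\<close> limits the effect of \<open>\<epsilon> *\<^sub>R E\<close>
    to c/4, so of the coercivity constant c at least c/4 remains.\<close>
  define \<delta> where "\<delta> = min (c / 2) (l / 2)"
  define r where "r = c / (4 * K)"
  have \<delta>: "\<delta> > 0" "\<delta> \<le> c / 2" "\<delta> < l" and r: "r > 0" "r * K = c / 4"
    using \<open>c > 0\<close> \<open>l > 0\<close> K(1) by (auto simp: \<delta>_def r_def)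
  define H where "H = (\<lambda>\<epsilon> m. A + \<epsilon> *\<^sub>R E + m *\<^sub>R mat 1)"
  have H_coercive: "c / 4 * (v \<bullet> v) \<le> v \<bullet> (H \<epsilon> m *v v)"
    if "\<bar>\<epsilon>\<bar> \<le> r" "\<bar>m - l\<bar> \<le> \<delta>" for \<epsilon> m v
  proof -
    have "\<bar>v \<bullet> (E *v v)\<bar> \<le> norm v * (norm v * K)"
      by (rule order_trans[OF Cauchy_Schwarz_ineq2]) (simp add: K(2) mult_left_mono)
    then have "\<bar>\<epsilon>\<bar> * \<bar>v \<bullet> (E *v v)\<bar> \<le> r * (norm v * (norm v * K))"
      using that(1) by (intro mult_mono) auto
    also have "\<dots> = c / 4 * (v \<bullet> v)"
      using r(2) by (simp add: dot_square_norm power2_eq_square)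
    finally have 1: "- (c / 4 * (v \<bullet> v)) \<le> \<epsilon> * (v \<bullet> (E *v v))"
      by (simp add: abs_mult[symmetric])
    have 2: "- (c / 2) * (v \<bullet> v) \<le> (m - l) * (v \<bullet> v)"
      using that(2) \<delta>(2) by (intro mult_right_mono) auto
    have "v \<bullet> (H \<epsilon> m *v v) =
        v \<bullet> ((A + l *\<^sub>R mat 1) *v v) + \<epsilon> * (v \<bullet> (E *v v)) + (m - l) * (v \<bullet> v)"
      by (simp add: H_def matrix_shift_mult inner_add_right scaleR_matrix_vector_assoc[symmetric]
          algebra_simps)
    then show ?thesis using 1 2 coercive[of v] by linarith
  qed
  have H_sym: "transpose (H \<epsilon> m) = H \<epsilon> m" for \<epsilon> m
    using symA symE by (simp add: H_def transpose_def vec_eq_iff mat_def eq_commute)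
  have H_pos_def: "pos_def (H \<epsilon> m)" if "\<bar>\<epsilon>\<bar> \<le> r" "\<bar>m - l\<bar> \<le> \<delta>" for \<epsilon> m
    unfolding pos_def_def
  proof (intro conjI allI impI H_sym)
    fix v :: "real^'n" assume "v \<noteq> 0"
    then have "0 < c / 4 * (v \<bullet> v)" using \<open>c > 0\<close> by simp
    then show "0 < v \<bullet> (H \<epsilon> m *v v)"
      using H_coercive[OF that, of v] by linarith
  qed
  \<comment> \<open>A choice function, known to solve the system only for \<epsilon> and
    \<open>m\<close> in the window where \<open>H \<epsilon> m\<close> is positive definite.\<close>
  define X where "X = (\<lambda>\<epsilon> m. SOME z. H \<epsilon> m *v z = - (g + \<epsilon> *\<^sub>R e))"
  have X: "H \<epsilon> m *v X \<epsilon> m = - (g + \<epsilon> *\<^sub>R e)" if "\<bar>\<epsilon>\<bar> \<le> r" "\<bar>m - l\<bar> \<le> \<delta>" for \<epsilon> m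
    unfolding X_def by (rule someI_ex[OF pos_def_solvable[OF H_pos_def[OF that]]])
  have X_tendsto: "((\<lambda>\<epsilon>. X \<epsilon> m) \<longlongrightarrow> X 0 m) (nhds 0)" if m: "\<bar>m - l\<bar> \<le> \<delta>" for m
  proof (rule coercive_solution_tendsto)
    have "\<forall>\<^sub>F \<epsilon> in nhds 0. \<bar>\<epsilon>\<bar> \<le> r"
      unfolding eventually_nhds_metric using r(1) by (auto intro!: exI[of _ r] simp: dist_real_def)
    then show "\<forall>\<^sub>F \<epsilon> in nhds 0. (\<forall>v. c / 4 * (v \<bullet> v) \<le> v \<bullet> (H \<epsilon> m *v v)) \<and>
        H \<epsilon> m *v X \<epsilon> m = - (g + \<epsilon> *\<^sub>R e)"
      by eventually_elim (use H_coercive X m in blast)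
    have id: "((\<lambda>\<epsilon>. \<epsilon>) \<longlongrightarrow> (0::real)) (nhds 0)" by (simp add: filterlim_ident)
    show "((\<lambda>\<epsilon>. H \<epsilon> m) \<longlongrightarrow> H 0 m) (nhds 0)"
      unfolding H_def by (intro tendsto_intros id)
    show "((\<lambda>\<epsilon>. - (g + \<epsilon> *\<^sub>R e)) \<longlongrightarrow> - (g + 0 *\<^sub>R e)) (nhds 0)"
      by (intro tendsto_intros id)
  qed (use \<open>c > 0\<close> X m r in auto)
  have H0: "H 0 m = A + m *\<^sub>R mat 1" for m by (simp add: H_def)
  have X0: "(A + m *\<^sub>R mat 1) *v X 0 m = (A + l *\<^sub>R mat 1) *v x" "X 0 m \<noteq> 0"
    if "\<bar>m - l\<bar> \<le> \<delta>" for m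
    using X[of 0 m] that r(1) x(1) \<open>g \<noteq> 0\<close> by (auto simp: H0)
  have "x \<noteq> 0" using x(1) \<open>g \<noteq> 0\<close> by auto
  \<comment> \<open>At \<epsilon> = 0 the solution for \<open>l\<close> is \<open>x\<close>, of norm
    \<Delta>, so strict monotonicity puts the norms at the two ends of the window on opposite sides
    of \<Delta>.\<close>
  have "\<Delta> < norm (X 0 (l - \<delta>))"
    unfolding x(2)[symmetric]
  proof (rule shifted_solution_norm_less)
    show "pos_def (A + (l - \<delta>) *\<^sub>R mat 1)"
      using H_pos_def[of 0 "l - \<delta>"] \<delta> r(1) by (simp add: H0)
    show "(A + (l - \<delta>) *\<^sub>R mat 1) *v X 0 (l - \<delta>) = (A + l *\<^sub>R mat 1) *v x"
      using X0(1)[of "l - \<delta>"] \<delta> by simp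
  qed (use \<delta> \<open>x \<noteq> 0\<close> in auto)
  moreover have "norm (X 0 (l + \<delta>)) < \<Delta>"
    unfolding x(2)[symmetric]
  proof (rule shifted_solution_norm_less)
    show "pos_def (A + l *\<^sub>R mat 1)"
      using H_pos_def[of 0 l] \<delta> r(1) by (simp add: H0)
    show "(A + l *\<^sub>R mat 1) *v x = (A + (l + \<delta>) *\<^sub>R mat 1) *v X 0 (l + \<delta>)"
      using X0(1)[of "l + \<delta>"] \<delta> by simp
    show "X 0 (l + \<delta>) \<noteq> 0"
      using X0(2)[of "l + \<delta>"] \<delta> by simp
  qed (use \<delta> in auto)
  \<comment> \<open>Both inequalities are strict, hence persist for small \<epsilon>.\<close>
  ultimately have "\<forall>\<^sub>F \<epsilon> in nhds 0. \<Delta> < norm (X \<epsilon> (l - \<delta>)) \<and> norm (X \<epsilon> (l + \<delta>)) < \<Delta>"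
    using \<delta> by (intro eventually_conj order_tendstoD[OF tendsto_norm[OF X_tendsto]]) auto
  then obtain d where d: "d > 0"
    "\<And>\<epsilon>. \<bar>\<epsilon>\<bar> < d \<Longrightarrow> \<Delta> < norm (X \<epsilon> (l - \<delta>)) \<and> norm (X \<epsilon> (l + \<delta>)) < \<Delta>"
    unfolding eventually_nhds_metric by (auto simp: dist_real_def)
  show ?thesis
  proof
    show "min d r > 0" using d r by simp
    fix \<epsilon> :: real assume "\<bar>\<epsilon>\<bar> < min d r"
    then have \<epsilon>: "\<bar>\<epsilon>\<bar> < d" "\<bar>\<epsilon>\<bar> \<le> r" by auto
    \<comment> \<open>Now \<epsilon> is fixed and \<open>m\<close> varies: continuity in
      \<open>m\<close> is what the intermediate value theorem needs.\<close>
    have "continuous_on {l - \<delta>..l + \<delta>} (X \<epsilon>)"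
      unfolding continuous_on_def
    proof
      fix m assume m: "m \<in> {l - \<delta>..l + \<delta>}"
      show "(X \<epsilon> \<longlongrightarrow> X \<epsilon> m) (at m within {l - \<delta>..l + \<delta>})"
      proof (rule coercive_solution_tendsto)
        have "(\<forall>v. c / 4 * (v \<bullet> v) \<le> v \<bullet> (H \<epsilon> t *v v)) \<and> H \<epsilon> t *v X \<epsilon> t = - (g + \<epsilon> *\<^sub>R e)"
          if "t \<in> {l - \<delta>..l + \<delta>}" for t
          using that by (intro conjI allI H_coercive X \<epsilon>) auto
        then show "\<forall>\<^sub>F t in at m within {l - \<delta>..l + \<delta>}.
            (\<forall>v. c / 4 * (v \<bullet> v) \<le> v \<bullet> (H \<epsilon> t *v v)) \<and> H \<epsilon> t *v X \<epsilon> t = - (g + \<epsilon> *\<^sub>R e)"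
          unfolding eventually_at_filter by (intro always_eventually) blast
        show "(H \<epsilon> \<longlongrightarrow> H \<epsilon> m) (at m within {l - \<delta>..l + \<delta>})"
          unfolding H_def by (intro tendsto_intros)
        show "H \<epsilon> m *v X \<epsilon> m = - (g + \<epsilon> *\<^sub>R e)"
          using m by (intro X \<epsilon>) auto
      qed (use \<open>c > 0\<close> in auto)
    qed
    then have "continuous_on {l - \<delta>..l + \<delta>} (\<lambda>m. norm (X \<epsilon> m))"
      by (rule continuous_on_norm)
    then obtain m where m: "l - \<delta> \<le> m" "m \<le> l + \<delta>" "norm (X \<epsilon> m) = \<Delta>"
      using IVT2'[of "\<lambda>m. norm (X \<epsilon> m)" "l + \<delta>" \<Delta> "l - \<delta>"] d(2)[OF \<epsilon>(1)] \<delta>(1) by auto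
    then have "\<bar>m - l\<bar> \<le> \<delta>" by auto
    then show "\<exists>m z. m > 0 \<and> \<bar>m - l\<bar> \<le> c / 2 \<and> pos_def (A + \<epsilon> *\<^sub>R E + m *\<^sub>R mat 1) \<and>
        (A + \<epsilon> *\<^sub>R E + m *\<^sub>R mat 1) *v z = - (g + \<epsilon> *\<^sub>R e) \<and> norm z = \<Delta>"
      using H_pos_def[of \<epsilon> m] X[of \<epsilon> m] \<epsilon>(2) m \<delta> unfolding H_def
      by (intro exI[of _ m] exI[of _ "X \<epsilon> m"]) auto
  qed
qed

section \<open>Differentiating the multiplier\<close>

text \<open>The a priori bound c/2 on the change of the multiplier already makes \<open>z\<close>
  Lipschitz at 0; differentiability of \<open>m\<close>, and with it continuity, comes out of the
  identity tested against \<open>w\<close>.\<close>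

lemma trs_multiplier_derivative:
  fixes A E :: "real^'n^'n" and g e x w :: "real^'n"
    and m :: "real \<Rightarrow> real" and z :: "real \<Rightarrow> real^'n"
  assumes symA: "transpose A = A" and "c > 0"
    and coercive: "\<And>v. c * (v \<bullet> v) \<le> v \<bullet> ((A + l *\<^sub>R mat 1) *v v)"
    and x: "(A + l *\<^sub>R mat 1) *v x = - g" "norm x = \<Delta>"
    and w: "(A + l *\<^sub>R mat 1) *v w = x" and "w \<bullet> x \<noteq> 0" and "m 0 = l"
    and ev: "\<forall>\<^sub>F \<epsilon> in at 0. \<bar>m \<epsilon> - l\<bar> \<le> c / 2 \<and> norm (z \<epsilon>) = \<Delta> \<and>
      (A + \<epsilon> *\<^sub>R E + m \<epsilon> *\<^sub>R mat 1) *v z \<epsilon> = - (g + \<epsilon> *\<^sub>R e)"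
  shows "(m has_real_derivative - (w \<bullet> (E *v x + e)) / (w \<bullet> x)) (at 0)"
proof -
  obtain K where K: "K > 0" "\<And>v. norm (E *v v) \<le> norm v * K"
    using bounded_linear.pos_bounded[OF matrix_vector_mul_bounded_linear] by blast
  define L where "L = 2 * (\<Delta> * K + norm e) / c"
  have ev': "\<forall>\<^sub>F \<epsilon> in at 0. norm (z \<epsilon> - x) \<le> L * \<bar>\<epsilon>\<bar> \<and>
      (m \<epsilon> - l) * (w \<bullet> z \<epsilon>) =
        - \<epsilon> * (w \<bullet> (E *v z \<epsilon> + e)) + (z \<epsilon> - x) \<bullet> (z \<epsilon> - x) / 2"
    using ev
  proof eventually_elim
    case (elim \<epsilon>)
    define d where "d = z \<epsilon> - x"
    have eq: "A *v z \<epsilon> + \<epsilon> *\<^sub>R (E *v z \<epsilon>) + m \<epsilon> *\<^sub>R z \<epsilon> = A *v x + l *\<^sub>R x - \<epsilon> *\<^sub>R e"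
      using elim x(1) by (simp add: matrix_shift_mult matrix_add_scaleR_mult)
    have sq: "z \<epsilon> \<bullet> z \<epsilon> = x \<bullet> x"
      using elim x(2) by (simp add: dot_square_norm)
    \<comment> \<open>Equal norms turn the inner product of \<open>d\<close> with
      \<open>z \<epsilon>\<close>, which looks first order in \<open>d\<close>, into a quadratic
      one.\<close>
    then have dz: "d \<bullet> z \<epsilon> = d \<bullet> d / 2" and dd: "d \<bullet> d = 2 * (x \<bullet> x) - 2 * (x \<bullet> z \<epsilon>)"
      by (simp_all add: d_def inner_diff_left inner_diff_right inner_commute)
    have "A *v d + l *\<^sub>R d = - \<epsilon> *\<^sub>R (E *v z \<epsilon> + e) - (m \<epsilon> - l) *\<^sub>R z \<epsilon>"
      using eq by (simp add: d_def matrix_vector_mult_diff_distrib algebra_simps)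
    then have "d \<bullet> ((A + l *\<^sub>R mat 1) *v d) =
        - \<epsilon> * (d \<bullet> (E *v z \<epsilon> + e)) - (m \<epsilon> - l) * (d \<bullet> d / 2)"
      by (simp add: matrix_shift_mult inner_diff_right dz del: scaleR_minus_left)
    \<comment> \<open>The multiplier term is absorbed by half of the coercive term
      \<open>c * (d \<bullet> d)\<close>; the other half yields the Lipschitz bound.\<close>
    moreover have "- (m \<epsilon> - l) * (d \<bullet> d / 2) \<le> c / 2 * (d \<bullet> d)"
    proof -
      have "- (m \<epsilon> - l) * (d \<bullet> d / 2) \<le> c * (d \<bullet> d / 2)"
      proof (rule mult_right_mono)
        show "- (m \<epsilon> - l) \<le> c" using elim \<open>c > 0\<close> by linarith
      qed simp
      then show ?thesis by simp
    qed
    moreover have "- \<epsilon> * (d \<bullet> (E *v z \<epsilon> + e)) \<le> \<bar>\<epsilon>\<bar> * (norm d * (\<Delta> * K + norm e))"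
    proof -
      have "\<bar>d \<bullet> (E *v z \<epsilon> + e)\<bar> \<le> norm d * norm (E *v z \<epsilon> + e)"
        by (rule Cauchy_Schwarz_ineq2)
      also have "\<dots> \<le> norm d * (\<Delta> * K + norm e)"
        using norm_triangle_ineq[of "E *v z \<epsilon>" e] K(2)[of "z \<epsilon>"] elim
        by (intro mult_left_mono) auto
      finally have "\<bar>\<epsilon>\<bar> * \<bar>d \<bullet> (E *v z \<epsilon> + e)\<bar> \<le> \<bar>\<epsilon>\<bar> * (norm d * (\<Delta> * K + norm e))"
        by (rule mult_left_mono) simp
      then show ?thesis by (simp add: abs_mult[symmetric])
    qed
    ultimately have "c / 2 * (d \<bullet> d) \<le> \<bar>\<epsilon>\<bar> * (norm d * (\<Delta> * K + norm e))"
      using coercive[of d] by (simp add: field_simps)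
    then have "norm d * (c / 2 * norm d) \<le> norm d * (\<bar>\<epsilon>\<bar> * (\<Delta> * K + norm e))"
      by (simp add: dot_square_norm power2_eq_square mult_ac)
    moreover have "0 \<le> \<bar>\<epsilon>\<bar> * (\<Delta> * K + norm e)"
      using x(2) K(1) by (intro mult_nonneg_nonneg add_nonneg_nonneg) auto
    ultimately have "c / 2 * norm d \<le> \<bar>\<epsilon>\<bar> * (\<Delta> * K + norm e)"
      by (cases "d = 0") (simp, metis mult_left_le_imp_le zero_less_norm_iff)
    then have 1: "norm d \<le> L * \<bar>\<epsilon>\<bar>"
      using \<open>c > 0\<close> by (simp add: L_def field_simps)
    have Aw: "A *v w = x - l *\<^sub>R w"
      using w by (simp add: matrix_shift_mult eq_diff_eq)
    have wA: "w \<bullet> (A *v v) = v \<bullet> x - l * (v \<bullet> w)" for v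
      using symmetric_inner_matrix[OF symA, of w v] by (simp add: Aw inner_diff_right)
    \<comment> \<open>By symmetry, testing with \<open>w\<close> replaces
      \<open>(A + l *\<^sub>R mat 1) *v d\<close> by \<open>x \<bullet> d\<close>, which equals
      \<open>- (d \<bullet> d) / 2\<close>.\<close>
    have "w \<bullet> (A *v z \<epsilon> + \<epsilon> *\<^sub>R (E *v z \<epsilon>) + m \<epsilon> *\<^sub>R z \<epsilon>) = w \<bullet> (A *v x + l *\<^sub>R x - \<epsilon> *\<^sub>R e)"
      by (simp only: eq)
    then have "(m \<epsilon> - l) * (w \<bullet> z \<epsilon>) = - \<epsilon> * (w \<bullet> (E *v z \<epsilon> + e)) + d \<bullet> d / 2"
      unfolding dd by (simp add: inner_add_right inner_diff_right wA algebra_simps inner_commute)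
    with 1 show ?case by (simp add: d_def)
  qed
  have z: "(z \<longlongrightarrow> x) (at 0)"
  proof -
    have "((\<lambda>\<epsilon>. L * \<bar>\<epsilon>\<bar>) \<longlongrightarrow> L * \<bar>0\<bar>) (at 0)" by (intro tendsto_intros)
    then have "((\<lambda>\<epsilon>. L * \<bar>\<epsilon>\<bar>) \<longlongrightarrow> 0) (at 0)" by simp
    moreover have "\<forall>\<^sub>F \<epsilon> in at 0. norm (z \<epsilon> - x) \<le> L * \<bar>\<epsilon>\<bar>"
      using ev' by eventually_elim blast
    ultimately have "((\<lambda>\<epsilon>. z \<epsilon> - x) \<longlongrightarrow> 0) (at 0)"
      by (rule Lim_null_comparison[rotated])
    then show ?thesis by (simp add: LIM_zero_iff)
  qed
  \<comment> \<open>By the Lipschitz bound the numerator is of order \<epsilon> squared, so one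
    division by \<epsilon> still leaves a null sequence.\<close>
  have quad: "((\<lambda>\<epsilon>. (z \<epsilon> - x) \<bullet> (z \<epsilon> - x) / (2 * \<epsilon>)) \<longlongrightarrow> 0) (at 0)"
  proof (rule Lim_null_comparison)
    show "\<forall>\<^sub>F \<epsilon> in at 0. norm ((z \<epsilon> - x) \<bullet> (z \<epsilon> - x) / (2 * \<epsilon>)) \<le> L\<^sup>2 / 2 * \<bar>\<epsilon>\<bar>"
      using ev' eventually_neq_at_within[of 0 0 UNIV]
    proof eventually_elim
      case (elim \<epsilon>)
      then have "(norm (z \<epsilon> - x))\<^sup>2 \<le> (L * \<bar>\<epsilon>\<bar>)\<^sup>2"
        by (intro power_mono) auto
      with elim show ?case
        by (simp add: dot_square_norm power_mult_distrib field_simps power2_eq_square abs_mult)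
    qed
    have "((\<lambda>\<epsilon>. L\<^sup>2 / 2 * \<bar>\<epsilon>\<bar>) \<longlongrightarrow> L\<^sup>2 / 2 * \<bar>0\<bar>) (at 0)" by (intro tendsto_intros)
    then show "((\<lambda>\<epsilon>. L\<^sup>2 / 2 * \<bar>\<epsilon>\<bar>) \<longlongrightarrow> 0) (at 0)" by simp
  qed
  have wz: "((\<lambda>\<epsilon>. w \<bullet> z \<epsilon>) \<longlongrightarrow> w \<bullet> x) (at 0)"
    by (intro tendsto_intros z)
  have Ez: "((\<lambda>\<epsilon>. E *v z \<epsilon>) \<longlongrightarrow> E *v x) (at 0)"
    by (rule bounded_linear.tendsto[OF matrix_vector_mul_bounded_linear z])
  have "((\<lambda>\<epsilon>. (- (w \<bullet> (E *v z \<epsilon> + e)) + (z \<epsilon> - x) \<bullet> (z \<epsilon> - x) / (2 * \<epsilon>)) / (w \<bullet> z \<epsilon>))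
      \<longlongrightarrow> (- (w \<bullet> (E *v x + e)) + 0) / (w \<bullet> x)) (at 0)"
    by (intro tendsto_intros Ez quad wz \<open>w \<bullet> x \<noteq> 0\<close>)
  moreover have "\<forall>\<^sub>F \<epsilon> in at 0.
      (- (w \<bullet> (E *v z \<epsilon> + e)) + (z \<epsilon> - x) \<bullet> (z \<epsilon> - x) / (2 * \<epsilon>)) / (w \<bullet> z \<epsilon>) =
      (m \<epsilon> - m 0) / (\<epsilon> - 0)"
    using ev' eventually_neq_at_within[of 0 0 UNIV]
      tendsto_imp_eventually_ne[OF wz \<open>w \<bullet> x \<noteq> 0\<close>]
  proof eventually_elim
    case (elim \<epsilon>)
    then have quot: "m \<epsilon> - l = (- \<epsilon> * (w \<bullet> (E *v z \<epsilon> + e)) + (z \<epsilon> - x) \<bullet> (z \<epsilon> - x) / 2) / (w \<bullet> z \<epsilon>)"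
      by (simp only: eq_divide_eq not_False_eq_True if_True)
    show ?case
      unfolding \<open>m 0 = l\<close> quot using elim(2,3) by (simp add: field_simps)
  qed
  ultimately show ?thesis
    unfolding has_field_derivative_iff by (auto intro: Lim_transform_eventually)
qed

section \<open>Block vectors and the action of the block matrix\<close>

lemma block_vector_eq_iff:
  "block_vector u w = block_vector u' w' \<longleftrightarrow> u = u' \<and> w = w'"
  by (auto simp: block_vector_def vec_eq_iff split: sum.split)

lemma block_vector_cases:
  obtains u w where "v = block_vector u w"
proof
  show "v = block_vector (\<chi> k. v $ Inl k) (\<chi> k. v $ Inr k)"
    by (simp add: block_vector_def vec_eq_iff split: sum.split)
qed

lemma block_vector_zero: "block_vector 0 0 = 0"
  by (simp add: block_vector_def vec_eq_iff split: sum.split)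

lemma scaleR_block_vector:
  fixes u w :: "real^'n"
  shows "t *\<^sub>R block_vector u w = block_vector (t *\<^sub>R u) (t *\<^sub>R w)"
  by (simp add: block_vector_def vec_eq_iff split: sum.split)

lemma block_vector_add:
  fixes u w :: "real^'n"
  shows "block_vector u w + block_vector u' w' = block_vector (u + u') (w + w')"
  by (simp add: block_vector_def vec_eq_iff split: sum.split)

lemma block_vector_diff:
  fixes u w :: "real^'n"
  shows "block_vector u w - block_vector u' w' = block_vector (u - u') (w - w')"
  by (simp add: block_vector_def vec_eq_iff split: sum.split)

lemma block_matrix_mult_block_vector:
  fixes P Q R S :: "real^'n^'n"
  shows "block_matrix P Q R S *v block_vector u w =
    block_vector (P *v u + Q *v w) (R *v u + S *v w)"
  by (simp add: block_matrix_def block_vector_def matrix_vector_mult_def vec_eq_iff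
      UNIV_Plus_UNIV[symmetric] sum.Plus split: sum.split del: UNIV_Plus_UNIV)

lemma outer_product_mult: "outer_product u v *v w = (v \<bullet> w) *\<^sub>R u"
  by (simp add: outer_product_def matrix_vector_mult_def vec_eq_iff inner_vec_def
      sum_distrib_left sum_distrib_right mult_ac)

lemma matrix_uminus_mult:
  fixes B :: "real^'n^'m"
  shows "(- B) *v v = - (B *v v)"
  by (simp add: matrix_vector_mult_def vec_eq_iff sum_negf)

lemma trs_matrix_mult_block_vector:
  "trs_matrix B b \<Delta> *v block_vector u w =
    block_vector (((b \<bullet> w) / \<Delta>\<^sup>2) *\<^sub>R b - B *v u) (u - B *v w)"
  by (simp add: trs_matrix_def block_matrix_mult_block_vector scaleR_matrix_vector_assoc[symmetric]
      outer_product_mult matrix_uminus_mult)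

section \<open>Complex eigenvalues and the rightmost eigenvalue\<close>

text \<open>Splitting an eigenvector into real part \<open>p\<close> and imaginary part
  \<open>q\<close> lets the spectral argument use only real inner products and the symmetry of real
  matrices.\<close>

lemma complex_eigenvalue_iff_real:
  fixes N :: "real^'m^'m"
  shows "complex_eigenvalue N \<mu> \<longleftrightarrow> (\<exists>p q. (p \<noteq> 0 \<or> q \<noteq> 0) \<and>
    N *v p = Re \<mu> *\<^sub>R p - Im \<mu> *\<^sub>R q \<and> N *v q = Re \<mu> *\<^sub>R q + Im \<mu> *\<^sub>R p)" (is "_ \<longleftrightarrow> ?R")
proof -
  have eq: "(\<chi> i j. complex_of_real (N $ i $ j)) *v v = \<mu> *s v \<longleftrightarrow>
      N *v (\<chi> i. Re (v $ i)) = Re \<mu> *\<^sub>R (\<chi> i. Re (v $ i)) - Im \<mu> *\<^sub>R (\<chi> i. Im (v $ i)) \<and>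
      N *v (\<chi> i. Im (v $ i)) = Re \<mu> *\<^sub>R (\<chi> i. Im (v $ i)) + Im \<mu> *\<^sub>R (\<chi> i. Re (v $ i))" for v
    by (auto simp: vec_eq_iff complex_eq_iff matrix_vector_mult_def)
  show ?thesis
  proof
    assume "complex_eigenvalue N \<mu>"
    then obtain v where v: "v \<noteq> 0" "(\<chi> i j. complex_of_real (N $ i $ j)) *v v = \<mu> *s v"
      unfolding complex_eigenvalue_def by blast
    then have "(\<chi> i. Re (v $ i)) \<noteq> 0 \<or> (\<chi> i. Im (v $ i)) \<noteq> 0"
      by (auto simp: vec_eq_iff complex_eq_iff)
    then show ?R using v(2) unfolding eq by blast
  next
    assume ?R
    then obtain p q where pq: "p \<noteq> 0 \<or> q \<noteq> 0" "N *v p = Re \<mu> *\<^sub>R p - Im \<mu> *\<^sub>R q"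
      "N *v q = Re \<mu> *\<^sub>R q + Im \<mu> *\<^sub>R p" by blast
    define v where "v = (\<chi> i. Complex (p $ i) (q $ i))"
    have "(\<chi> i. Re (v $ i)) = p" "(\<chi> i. Im (v $ i)) = q" "v \<noteq> 0"
      using pq(1) by (auto simp: v_def vec_eq_iff complex_eq_iff)
    then show "complex_eigenvalue N \<mu>"
      using pq(2,3) eq[of v] unfolding complex_eigenvalue_def by auto
  qed
qed

text \<open>An eigenvector is \<open>(x, w)\<close> with \<open>w\<close> the solution of
  \<open>(B + l *\<^sub>R mat 1) *v w = x\<close>: symmetry gives
  \<open>b \<bullet> w = - (x \<bullet> x)\<close>, so the rank-one block contributes exactly
  \<open>- b\<close>.\<close>

lemma trs_matrix_eigenvalue:
  fixes B :: "real^'n^'n"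
  assumes "pos_def (B + l *\<^sub>R mat 1)" and "(B + l *\<^sub>R mat 1) *v x = - b"
    and "norm x = \<Delta>" and "\<Delta> > 0"
  shows "complex_eigenvalue (trs_matrix B b \<Delta>) (complex_of_real l)"
proof -
  obtain w where w: "(B + l *\<^sub>R mat 1) *v w = x"
    using pos_def_solvable[OF assms(1)] by blast
  have "b = - ((B + l *\<^sub>R mat 1) *v x)" using assms(2) by simp
  then have "b \<bullet> w = - (w \<bullet> ((B + l *\<^sub>R mat 1) *v x))"
    by (simp add: inner_commute)
  also have "\<dots> = - (x \<bullet> x)"
    using symmetric_inner_matrix[of "B + l *\<^sub>R mat 1" w x] assms(1) w by (simp add: pos_def_def)
  finally have "(b \<bullet> w) / \<Delta>\<^sup>2 = - 1"
    using assms(3,4) by (simp add: dot_square_norm)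
  moreover have "- b - B *v x = l *\<^sub>R x" "x - B *v w = l *\<^sub>R w"
    using assms(2) w by (simp_all add: matrix_shift_mult scaleR_matrix_vector_assoc[symmetric] algebra_simps)
  ultimately have "trs_matrix B b \<Delta> *v block_vector x w = l *\<^sub>R block_vector x w"
    by (simp add: trs_matrix_mult_block_vector scaleR_block_vector)
  moreover have "block_vector x w \<noteq> 0"
    using assms(3,4) block_vector_eq_iff[of x w 0 0] by (auto simp: block_vector_zero)
  ultimately show ?thesis
    unfolding complex_eigenvalue_iff_real
    by (intro exI[of _ "block_vector x w"] exI[of _ 0]) simp
qed

text \<open>No other eigenvalue lies on or to the right of the vertical line through
  \<open>l\<close>; this yields both that \<open>l\<close> is rightmost and that it is the only
  rightmost eigenvalue.\<close>

lemma trs_matrix_eigenvalue_eq: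
  fixes B :: "real^'n^'n"
  assumes sym: "transpose B = B" and pd: "pos_def (B + l *\<^sub>R mat 1)"
    and x: "(B + l *\<^sub>R mat 1) *v x = - b" "norm x = \<Delta>" and "\<Delta> > 0"
    and "complex_eigenvalue (trs_matrix B b \<Delta>) \<mu>" and "l \<le> Re \<mu>"
  shows "\<mu> = complex_of_real l"
proof -
  define \<alpha> \<beta> where "\<alpha> = Re \<mu>" and "\<beta> = Im \<mu>"
  define H where "H = B + l *\<^sub>R mat 1"
  define a where "a = \<alpha> - l"
  have a: "a \<ge> 0" using assms(7) by (simp add: a_def \<alpha>_def)
  have symH: "transpose H = H" using pd by (simp add: H_def pos_def_def)
  have H: "B *v v + \<alpha> *\<^sub>R v = H *v v + a *\<^sub>R v" for v
    by (simp add: H_def matrix_shift_mult scaleR_matrix_vector_assoc[symmetric] a_def algebra_simps)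
  have H_nonneg: "v \<bullet> (H *v v) \<ge> 0" for v
    using pd unfolding pos_def_def H_def by (cases "v = 0") (auto simp: less_imp_le)
  obtain p q where "p \<noteq> 0 \<or> q \<noteq> 0"
    "trs_matrix B b \<Delta> *v p = \<alpha> *\<^sub>R p - \<beta> *\<^sub>R q" "trs_matrix B b \<Delta> *v q = \<alpha> *\<^sub>R q + \<beta> *\<^sub>R p"
    using assms(6) unfolding complex_eigenvalue_iff_real \<alpha>_def \<beta>_def by blast
  moreover obtain p1 p2 q1 q2 where "p = block_vector p1 p2" "q = block_vector q1 q2"
    by (metis block_vector_cases)
  ultimately have nz: "p1 \<noteq> 0 \<or> p2 \<noteq> 0 \<or> q1 \<noteq> 0 \<or> q2 \<noteq> 0"
    and eqs: "((b \<bullet> p2) / \<Delta>\<^sup>2) *\<^sub>R b - B *v p1 = \<alpha> *\<^sub>R p1 - \<beta> *\<^sub>R q1" "p1 - B *v p2 = \<alpha> *\<^sub>R p2 - \<beta> *\<^sub>R q2"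
      "((b \<bullet> q2) / \<Delta>\<^sup>2) *\<^sub>R b - B *v q1 = \<alpha> *\<^sub>R q1 + \<beta> *\<^sub>R p1" "q1 - B *v q2 = \<alpha> *\<^sub>R q2 + \<beta> *\<^sub>R p2"
    by (auto simp: trs_matrix_mult_block_vector scaleR_block_vector block_vector_add
        block_vector_diff block_vector_eq_iff block_vector_zero)
  define k1 k2 where "k1 = b \<bullet> p2" and "k2 = b \<bullet> q2"
  have p1: "H *v p2 + a *\<^sub>R p2 - \<beta> *\<^sub>R q2 = p1" and q1: "H *v q2 + a *\<^sub>R q2 + \<beta> *\<^sub>R p2 = q1"
    using eqs unfolding H[symmetric] by (simp_all add: algebra_simps)
  have Hp1: "H *v p1 + a *\<^sub>R p1 - \<beta> *\<^sub>R q1 = (k1 / \<Delta>\<^sup>2) *\<^sub>R b"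
    and Hq1: "H *v q1 + a *\<^sub>R q1 + \<beta> *\<^sub>R p1 = (k2 / \<Delta>\<^sup>2) *\<^sub>R b"
    using eqs unfolding H[symmetric] by (simp_all add: k1_def k2_def algebra_simps)
  text \<open>\<open>S\<close> is the squared norm of the complex vector \<open>u = p1 + \<i> q1\<close>; the real and imaginary
    parts of the bilinear square \<open>u\<^sup>T u\<close> are computed in \<open>re\<close> and \<open>im\<close>.\<close>
  define S where "S = p1 \<bullet> p1 + q1 \<bullet> q1"
  define k where "k = (k1\<^sup>2 + k2\<^sup>2) / \<Delta>\<^sup>2"
  \<comment> \<open>One factor \<open>u\<close> is written as (B + \<mu>) v, and the symmetric
    \<open>H\<close> is moved to the other factor, where the equation for \<open>u\<close>
    applies.\<close>
  have p1v: "p1 \<bullet> v = p2 \<bullet> (H *v v) + a * (p2 \<bullet> v) - \<beta> * (q2 \<bullet> v)" for v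
    unfolding p1[symmetric] using symmetric_inner_matrix[OF symH, of v p2]
    by (simp add: inner_add_left inner_diff_left inner_commute[of "H *v p2"])
  have q1v: "q1 \<bullet> v = q2 \<bullet> (H *v v) + a * (q2 \<bullet> v) + \<beta> * (p2 \<bullet> v)" for v
    unfolding q1[symmetric] using symmetric_inner_matrix[OF symH, of v q2]
    by (simp add: inner_add_left inner_diff_left inner_commute[of "H *v q2"])
  have vHp1: "v \<bullet> (H *v p1) + a * (v \<bullet> p1) - \<beta> * (v \<bullet> q1) = k1 / \<Delta>\<^sup>2 * (b \<bullet> v)" for v
    using arg_cong[OF Hp1, of "inner v"]
    by (simp add: inner_add_right inner_diff_right inner_commute)
  have vHq1: "v \<bullet> (H *v q1) + a * (v \<bullet> q1) + \<beta> * (v \<bullet> p1) = k2 / \<Delta>\<^sup>2 * (b \<bullet> v)" for v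
    using arg_cong[OF Hq1, of "inner v"]
    by (simp add: inner_add_right inner_diff_right inner_commute)
  have re: "p1 \<bullet> p1 - q1 \<bullet> q1 = (k1\<^sup>2 - k2\<^sup>2) / \<Delta>\<^sup>2"
  proof -
    have "p1 \<bullet> p1 - q1 \<bullet> q1 = k1 / \<Delta>\<^sup>2 * (b \<bullet> p2) - k2 / \<Delta>\<^sup>2 * (b \<bullet> q2)"
      unfolding vHp1[symmetric] vHq1[symmetric] p1v[of p1] q1v[of q1] by simp
    then show ?thesis
      by (simp add: k1_def[symmetric] k2_def[symmetric] power2_eq_square diff_divide_distrib)
  qed
  have im: "2 * (p1 \<bullet> q1) = 2 * k1 * k2 / \<Delta>\<^sup>2"
  proof -
    have "p1 \<bullet> q1 + q1 \<bullet> p1 = k2 / \<Delta>\<^sup>2 * (b \<bullet> p2) + k1 / \<Delta>\<^sup>2 * (b \<bullet> q2)"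
      unfolding vHp1[symmetric] vHq1[symmetric] p1v[of q1] q1v[of p1] by simp
    then show ?thesis
      by (simp add: k1_def[symmetric] k2_def[symmetric] inner_commute[of q1] mult.commute)
  qed
  \<comment> \<open>\<open>k\<close> is the modulus of the bilinear square of \<open>u\<close>,
    which Cauchy-Schwarz bounds by the squared norm \<open>S\<close>.\<close>
  have "k\<^sup>2 = ((k1\<^sup>2 - k2\<^sup>2) / \<Delta>\<^sup>2)\<^sup>2 + (2 * k1 * k2 / \<Delta>\<^sup>2)\<^sup>2"
    by (simp add: k_def power_divide add_divide_distrib[symmetric]) (simp add: power2_eq_square algebra_simps)
  also have "\<dots> = (p1 \<bullet> p1 - q1 \<bullet> q1)\<^sup>2 + (2 * (p1 \<bullet> q1))\<^sup>2"
    by (simp only: re im)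
  also have "\<dots> \<le> S\<^sup>2"
    using Cauchy_Schwarz_ineq[of p1 q1] by (simp add: S_def power2_eq_square algebra_simps)
  finally have kS: "k \<le> S"
    by (rule power2_le_imp_le) (simp add: S_def)

  \<comment> \<open>\<open>r\<close> and \<open>s\<close> are the real and imaginary parts of the
    preimage of \<open>u\<close> under \<open>H\<close>. Cancelling \<open>H\<close> in the equation
    for \<open>u\<close> gives \<open>xp\<close> and \<open>xq\<close>.\<close>
  obtain r s where r: "H *v r = p1" and s: "H *v s = q1"
    using pos_def_solvable[OF pd] unfolding H_def by blast
  have "H *v (p1 + a *\<^sub>R r - \<beta> *\<^sub>R s) = H *v (- (k1 / \<Delta>\<^sup>2) *\<^sub>R x)"
    "H *v (q1 + a *\<^sub>R s + \<beta> *\<^sub>R r) = H *v (- (k2 / \<Delta>\<^sup>2) *\<^sub>R x)"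
    using Hp1 Hq1 x(1) unfolding H_def[symmetric]
    by (simp_all add: matrix_vector_mult_diff_distrib matrix_vector_mult_scaleR r s
        matrix_vector_right_distrib linear_neg[OF matrix_vector_mul_linear])
  then have xp: "p1 + a *\<^sub>R r - \<beta> *\<^sub>R s = - (k1 / \<Delta>\<^sup>2) *\<^sub>R x"
    and xq: "q1 + a *\<^sub>R s + \<beta> *\<^sub>R r = - (k2 / \<Delta>\<^sup>2) *\<^sub>R x"
    using injD[OF pos_def_inj[OF pd]] unfolding H_def[symmetric] by blast+
  \<comment> \<open>Since \<open>x\<close> has norm \<Delta>, \<open>k\<close> is also the squared
    norm of the right-hand sides of \<open>xp\<close> and \<open>xq\<close>. Expanding the left-hand
    sides gives \<open>S\<close> plus terms that are nonnegative or cancel by symmetry, so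
    \<open>k \<le> S\<close> makes them vanish.\<close>
  have "k = (- (k1 / \<Delta>\<^sup>2) *\<^sub>R x) \<bullet> (- (k1 / \<Delta>\<^sup>2) *\<^sub>R x) + (- (k2 / \<Delta>\<^sup>2) *\<^sub>R x) \<bullet> (- (k2 / \<Delta>\<^sup>2) *\<^sub>R x)"
    using x(2) \<open>\<Delta> > 0\<close> by (simp add: k_def dot_square_norm power2_eq_square field_simps)
  also have "\<dots> = S + 2 * a * (r \<bullet> p1 + s \<bullet> q1) + 2 * \<beta> * (r \<bullet> q1 - s \<bullet> p1) +
      (a\<^sup>2 + \<beta>\<^sup>2) * (r \<bullet> r + s \<bullet> s)"
    unfolding xp[symmetric] xq[symmetric] S_def
    by (simp add: inner_add_left inner_add_right inner_diff_left inner_diff_right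
        inner_commute power2_eq_square algebra_simps)
  also have "r \<bullet> q1 - s \<bullet> p1 = 0"
    using symmetric_inner_matrix[OF symH, of r s] by (simp add: r s)
  finally have "S + 2 * a * (r \<bullet> p1 + s \<bullet> q1) + (a\<^sup>2 + \<beta>\<^sup>2) * (r \<bullet> r + s \<bullet> s) \<le> S"
    using kS by simp
  moreover have "2 * a * (r \<bullet> p1 + s \<bullet> q1) \<ge> 0"
    using a H_nonneg[of r] H_nonneg[of s] by (simp add: r s)
  moreover have "(a\<^sup>2 + \<beta>\<^sup>2) * (r \<bullet> r + s \<bullet> s) \<ge> 0" by simp
  ultimately have "(a\<^sup>2 + \<beta>\<^sup>2) * (r \<bullet> r + s \<bullet> s) = 0" by linarith
  then consider "a = 0" "\<beta> = 0" | "r = 0" "s = 0"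
    by (auto simp: add_nonneg_eq_0_iff)
  then show ?thesis
  proof cases
    case 1
    then show ?thesis by (simp add: complex_eq_iff a_def \<alpha>_def \<beta>_def)
  next
    \<comment> \<open>Here \<open>u = 0\<close>, so (B + \<mu>) v = 0; the real part of its product
      with the conjugate of \<open>v\<close> forces \<open>v = 0\<close> by definiteness, and no
      eigenvector is left.\<close>
    case 2
    then have 0: "p1 = 0" "q1 = 0" using r s by auto
    have "p2 \<bullet> (H *v p2) + q2 \<bullet> (H *v q2) + a * (p2 \<bullet> p2 + q2 \<bullet> q2) = 0"
      using p1v[of p2] q1v[of q2] 0 by (simp add: inner_commute[of q2 p2] algebra_simps)
    moreover have "a * (p2 \<bullet> p2 + q2 \<bullet> q2) \<ge> 0" using a by simp
    ultimately have "p2 \<bullet> (H *v p2) \<le> 0" "q2 \<bullet> (H *v q2) \<le> 0"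
      using H_nonneg[of p2] H_nonneg[of q2] by linarith+
    then have "p2 = 0" "q2 = 0"
      using pd unfolding pos_def_def H_def by (meson not_less)+
    then show ?thesis using nz 0 by simp
  qed
qed

section \<open>Perturbed multiplier, eigenvector formula and rightmost eigenvalue combined\<close>

theorem theorem3p4:
  fixes A E :: "real^'n^'n"
    and g e x y\<^sub>1 y\<^sub>2 :: "real^'n"
    and \<Delta> l :: real
    and l\<epsilon> :: "real \<Rightarrow> real"
    and x\<epsilon> :: "real \<Rightarrow> real^'n"
  assumes "transpose A = A" and "transpose E = E" and "g \<noteq> 0" and "\<Delta> > 0"
    and "trs_easy_case A g \<Delta>"
    and "trs_solution A g \<Delta> l x"
    and "l > 0"
    and "\<And>\<epsilon>. trs_easy_case (A + \<epsilon> *\<^sub>R E) (g + \<epsilon> *\<^sub>R e) \<Delta> \<Longrightarrow>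
               trs_solution (A + \<epsilon> *\<^sub>R E) (g + \<epsilon> *\<^sub>R e) \<Delta> (l\<epsilon> \<epsilon>) (x\<epsilon> \<epsilon>)"
    and "norm (block_vector y\<^sub>1 y\<^sub>2) = 1"
    and "trs_matrix A g \<Delta> *v block_vector y\<^sub>1 y\<^sub>2 = l *\<^sub>R block_vector y\<^sub>1 y\<^sub>2"
  shows "\<exists>\<rho>>0.
      (\<forall>\<epsilon>. 0 < \<bar>\<epsilon>\<bar> \<and> \<bar>\<epsilon>\<bar> < \<rho> \<longrightarrow>
         l\<epsilon> \<epsilon> > 0 \<and>
         rightmost_eigenvalue (trs_matrix (A + \<epsilon> *\<^sub>R E) (g + \<epsilon> *\<^sub>R e) \<Delta>)
           (complex_of_real (l\<epsilon> \<epsilon>)) \<and>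
         (\<forall>\<mu>. rightmost_eigenvalue (trs_matrix (A + \<epsilon> *\<^sub>R E) (g + \<epsilon> *\<^sub>R e) \<Delta>) \<mu> \<longrightarrow>
                \<mu> = complex_of_real (l\<epsilon> \<epsilon>))) \<and>
      (l\<epsilon> \<longlongrightarrow> l) (at 0) \<and>
      (l\<epsilon> has_real_derivative
         sgn (g \<bullet> y\<^sub>2) * norm y\<^sub>1 / ((y\<^sub>1 \<bullet> y\<^sub>2) * \<Delta>) * (y\<^sub>2 \<bullet> (E *v x + e))) (at 0)"
proof -
  have mult: "(A + l *\<^sub>R mat 1) *v x = - g" and norm_x: "norm x = \<Delta>"
    using assms(6,7) by (auto simp: trs_solution_def trs_multiplier_def)
  have "x \<noteq> 0" using norm_x \<open>\<Delta> > 0\<close> by auto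
  \<comment> \<open>The easy case provides some multiplier with a definite matrix; uniqueness
    identifies it with the given \<open>l\<close>.\<close>
  have pd: "pos_def (A + l *\<^sub>R mat 1)"
  proof -
    obtain l' x' where l': "trs_solution A g \<Delta> l' x'" "pos_def (A + l' *\<^sub>R mat 1)"
      using assms(5) unfolding trs_easy_case_def by blast
    have "x' \<noteq> 0"
      using l'(1) \<open>g \<noteq> 0\<close> by (auto simp: trs_solution_def trs_multiplier_def)
    then have "l = l'"
      using trs_solution_unique(1)[OF assms(1) l' assms(6)] by simp
    then show ?thesis using l'(2) by simp
  qed
  obtain c where c: "c > 0" "\<And>v. c * (v \<bullet> v) \<le> v \<bullet> ((A + l *\<^sub>R mat 1) *v v)"
    using pos_def_coercive[OF pd] by blast
  have sym: "transpose (A + \<epsilon> *\<^sub>R E) = A + \<epsilon> *\<^sub>R E" for \<epsilon>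
    using assms(1,2) by (simp add: transpose_def vec_eq_iff)
  obtain \<rho> where \<rho>: "\<rho> > 0"
    "\<And>\<epsilon>. \<bar>\<epsilon>\<bar> < \<rho> \<Longrightarrow> \<exists>m z. m > 0 \<and> \<bar>m - l\<bar> \<le> c / 2 \<and>
      pos_def (A + \<epsilon> *\<^sub>R E + m *\<^sub>R mat 1) \<and>
      (A + \<epsilon> *\<^sub>R E + m *\<^sub>R mat 1) *v z = - (g + \<epsilon> *\<^sub>R e) \<and> norm z = \<Delta>"
    using trs_perturbed_multiplier_exists[OF assms(1,2,3,7) c mult norm_x] by blast
  \<comment> \<open>The root found above puts the perturbed subproblem in easy case, so
    \<open>l\<epsilon>\<close> and \<open>x\<epsilon>\<close> do solve it and agree with that root
    by uniqueness.\<close>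
  have main: "l\<epsilon> \<epsilon> > 0 \<and> \<bar>l\<epsilon> \<epsilon> - l\<bar> \<le> c / 2 \<and> pos_def (A + \<epsilon> *\<^sub>R E + l\<epsilon> \<epsilon> *\<^sub>R mat 1) \<and>
      (A + \<epsilon> *\<^sub>R E + l\<epsilon> \<epsilon> *\<^sub>R mat 1) *v x\<epsilon> \<epsilon> = - (g + \<epsilon> *\<^sub>R e) \<and> norm (x\<epsilon> \<epsilon>) = \<Delta>"
    if small: "\<bar>\<epsilon>\<bar> < \<rho>" for \<epsilon>
  proof -
    obtain m z where m: "m > 0" "\<bar>m - l\<bar> \<le> c / 2" "pos_def (A + \<epsilon> *\<^sub>R E + m *\<^sub>R mat 1)"
      "(A + \<epsilon> *\<^sub>R E + m *\<^sub>R mat 1) *v z = - (g + \<epsilon> *\<^sub>R e)" "norm z = \<Delta>"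
      using \<rho>(2)[OF small] by blast
    then have sol: "trs_solution (A + \<epsilon> *\<^sub>R E) (g + \<epsilon> *\<^sub>R e) \<Delta> m z"
      by (intro trs_solutionI sym) auto
    then have "trs_solution (A + \<epsilon> *\<^sub>R E) (g + \<epsilon> *\<^sub>R e) \<Delta> (l\<epsilon> \<epsilon>) (x\<epsilon> \<epsilon>)"
      using m(3) by (intro assms(8)) (auto simp: trs_easy_case_def)
    moreover have "z \<noteq> 0" using m(5) \<open>\<Delta> > 0\<close> by auto
    ultimately have "l\<epsilon> \<epsilon> = m" "x\<epsilon> \<epsilon> = z"
      using trs_solution_unique[OF sym sol m(3)] by auto
    then show ?thesis using m by simp
  qed
  have "l\<epsilon> 0 = l"
  proof -
    have "trs_solution A g \<Delta> (l\<epsilon> 0) (x\<epsilon> 0)" using assms(5) assms(8)[of 0] by simp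
    then show ?thesis by (rule trs_solution_unique(1)[OF assms(1,6) pd _ \<open>x \<noteq> 0\<close>])
  qed

  \<comment> \<open>The first block row of the eigenvector equation reads
    \<open>(A + l *\<^sub>R mat 1) *v y\<^sub>1 = \<kappa> *\<^sub>R g\<close>, whence
    \<open>y\<^sub>1\<close> is \<open>- \<kappa>\<close> times \<open>x\<close>;
    \<open>y\<^sub>2\<close> is the same multiple of \<open>w\<close>.\<close>
  define \<kappa> where "\<kappa> = (g \<bullet> y\<^sub>2) / \<Delta>\<^sup>2"
  have "\<kappa> *\<^sub>R g - A *v y\<^sub>1 = l *\<^sub>R y\<^sub>1" "y\<^sub>1 - A *v y\<^sub>2 = l *\<^sub>R y\<^sub>2"
    using assms(10) by (simp_all add: trs_matrix_mult_block_vector scaleR_block_vector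
        block_vector_eq_iff \<kappa>_def)
  then have Hy1: "(A + l *\<^sub>R mat 1) *v y\<^sub>1 = \<kappa> *\<^sub>R g" and Hy2: "(A + l *\<^sub>R mat 1) *v y\<^sub>2 = y\<^sub>1"
    by (simp_all add: matrix_shift_mult scaleR_matrix_vector_assoc[symmetric] algebra_simps)
  have "(A + l *\<^sub>R mat 1) *v y\<^sub>1 = (A + l *\<^sub>R mat 1) *v (- \<kappa> *\<^sub>R x)"
    unfolding matrix_vector_mult_scaleR mult Hy1 by simp
  then have y1: "y\<^sub>1 = - \<kappa> *\<^sub>R x" by (rule injD[OF pos_def_inj[OF pd]])
  \<comment> \<open>Otherwise both blocks would vanish, against unit length.\<close>
  have "\<kappa> \<noteq> 0"
  proof
    assume "\<kappa> = 0"
    then have "y\<^sub>1 = 0" using y1 by simp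
    moreover from this have "(A + l *\<^sub>R mat 1) *v y\<^sub>2 = (A + l *\<^sub>R mat 1) *v 0" using Hy2 by simp
    then have "y\<^sub>2 = 0" by (rule injD[OF pos_def_inj[OF pd]])
    ultimately show False using assms(9) by (simp add: block_vector_zero)
  qed
  define w where "w = (- 1 / \<kappa>) *\<^sub>R y\<^sub>2"
  have y2: "y\<^sub>2 = - \<kappa> *\<^sub>R w" using \<open>\<kappa> \<noteq> 0\<close> by (simp add: w_def)
  have w: "(A + l *\<^sub>R mat 1) *v w = x"
    unfolding w_def matrix_vector_mult_scaleR Hy2 y1 using \<open>\<kappa> \<noteq> 0\<close> by simp
  then have "w \<noteq> 0" using \<open>x \<noteq> 0\<close> by auto
  then have wx: "w \<bullet> x > 0" using pd w unfolding pos_def_def by metis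
  have "(l\<epsilon> has_real_derivative - (w \<bullet> (E *v x + e)) / (w \<bullet> x)) (at 0)"
  proof (rule trs_multiplier_derivative[where m = l\<epsilon> and z = x\<epsilon>,
        OF assms(1) c mult norm_x w _ \<open>l\<epsilon> 0 = l\<close>])
    show "\<forall>\<^sub>F \<epsilon> in at 0. \<bar>l\<epsilon> \<epsilon> - l\<bar> \<le> c / 2 \<and> norm (x\<epsilon> \<epsilon>) = \<Delta> \<and>
        (A + \<epsilon> *\<^sub>R E + l\<epsilon> \<epsilon> *\<^sub>R mat 1) *v x\<epsilon> \<epsilon> = - (g + \<epsilon> *\<^sub>R e)"
      unfolding eventually_at using \<rho>(1) main by (auto intro!: exI[of _ \<rho>])
  qed (use wx in simp)
  \<comment> \<open>The sign and \<open>norm y\<^sub>1\<close> combine to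
    \<open>\<kappa> * \<Delta>\<close>, while \<open>y\<^sub>1 \<bullet> y\<^sub>2\<close> carries
    the square of \<kappa> and the last factor \<open>- \<kappa>\<close>, so the normalisation of
    the eigenvector cancels.\<close>
  also have "- (w \<bullet> (E *v x + e)) / (w \<bullet> x) =
      sgn (g \<bullet> y\<^sub>2) * norm y\<^sub>1 / ((y\<^sub>1 \<bullet> y\<^sub>2) * \<Delta>) * (y\<^sub>2 \<bullet> (E *v x + e))"
  proof -
    have "sgn (g \<bullet> y\<^sub>2) = sgn \<kappa>"
      using \<open>\<Delta> > 0\<close> by (simp add: \<kappa>_def sgn_mult sgn_divide)
    moreover have "norm y\<^sub>1 = \<bar>\<kappa>\<bar> * \<Delta>" by (simp add: y1 norm_x)
    ultimately have "sgn (g \<bullet> y\<^sub>2) * norm y\<^sub>1 = \<kappa> * \<Delta>"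
      by (simp add: mult_sgn_abs mult.assoc[symmetric])
    then show ?thesis
      using \<open>\<Delta> > 0\<close> \<open>\<kappa> \<noteq> 0\<close> wx
      by (simp add: y1 y2 inner_commute[of x w] field_simps del: scaleR_minus_left)
  qed
  finally have deriv: "(l\<epsilon> has_real_derivative
      sgn (g \<bullet> y\<^sub>2) * norm y\<^sub>1 / ((y\<^sub>1 \<bullet> y\<^sub>2) * \<Delta>) * (y\<^sub>2 \<bullet> (E *v x + e))) (at 0)" .
  moreover have "(l\<epsilon> \<longlongrightarrow> l) (at 0)"
    using DERIV_isCont[OF deriv] \<open>l\<epsilon> 0 = l\<close> by (simp add: isCont_def)
  moreover have "l\<epsilon> \<epsilon> > 0 \<and>
      rightmost_eigenvalue (trs_matrix (A + \<epsilon> *\<^sub>R E) (g + \<epsilon> *\<^sub>R e) \<Delta>) (complex_of_real (l\<epsilon> \<epsilon>)) \<and>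
      (\<forall>\<mu>. rightmost_eigenvalue (trs_matrix (A + \<epsilon> *\<^sub>R E) (g + \<epsilon> *\<^sub>R e) \<Delta>) \<mu> \<longrightarrow>
        \<mu> = complex_of_real (l\<epsilon> \<epsilon>))"
    if "\<bar>\<epsilon>\<bar> < \<rho>" for \<epsilon>
  proof -
    let ?M = "trs_matrix (A + \<epsilon> *\<^sub>R E) (g + \<epsilon> *\<^sub>R e) \<Delta>"
    have "l\<epsilon> \<epsilon> > 0" and pd\<epsilon>: "pos_def (A + \<epsilon> *\<^sub>R E + l\<epsilon> \<epsilon> *\<^sub>R mat 1)"
      and eq: "(A + \<epsilon> *\<^sub>R E + l\<epsilon> \<epsilon> *\<^sub>R mat 1) *v x\<epsilon> \<epsilon> = - (g + \<epsilon> *\<^sub>R e)" "norm (x\<epsilon> \<epsilon>) = \<Delta>"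
      using main[OF that] by auto
    have "complex_eigenvalue ?M (complex_of_real (l\<epsilon> \<epsilon>))"
      by (rule trs_matrix_eigenvalue[OF pd\<epsilon> eq \<open>\<Delta> > 0\<close>])
    moreover have "\<mu> = complex_of_real (l\<epsilon> \<epsilon>)"
      if "complex_eigenvalue ?M \<mu>" "l\<epsilon> \<epsilon> \<le> Re \<mu>" for \<mu>
      by (rule trs_matrix_eigenvalue_eq[OF sym pd\<epsilon> eq \<open>\<Delta> > 0\<close> that])
    ultimately show ?thesis
      using \<open>l\<epsilon> \<epsilon> > 0\<close> unfolding rightmost_eigenvalue_def
      by (metis Re_complex_of_real linear order_refl)
  qed
  ultimately show ?thesis using \<rho>(1) by blast
qed

end
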